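(* Let $h \in \mathbb{R}[x]$ be $[-1,0]$-rooted and let $f \in \mathbb{R}[x]$ be real-rooted. (a) The polynomial $f \Diamond h$ is real-rooted, and if $g \in \mathbb{R}[x]$ satisfies $g \preceq f$, then $g \Diamond h \preceq f \Diamond h$. (b) If, in addition, $h$ is $(-1,0)$-rooted and simple-rooted and $f$ is simple-rooted, then $f \Diamond h$ is simple-rooted, and $g \Diamond h \prec f \Diamond h$ for all $g \in \mathbb{R}[x]$ with $g \prec f$.
   Context: The diamond product of two polynomials $f, g \in \mathbb{R}[x]$ is $$f \Diamond g = \sum_{n \geq 0}\frac{f^{(n)}(x)}{n!}\frac{g^{(n)}(x)}{n!}\, x^n(x+1)^n .$$ All polynomials called "rooted" in this statement are nonzero. A nonzero polynomial in $\mathbb{R}[x]$ is real-rooted if all its complex zeros are real, and $I$-rooted, for an interval $I \subseteq \mathbb{R}$, if all its complex zeros are real and lie in $I$. It is simple-rooted if all its zeros are simple. Nonzero constants satisfy all these conditions vacuously. Interlacing: for nonzero real-rooted $f,g$ with $\deg(f)=\deg(g)+1=d$, with zeros $\alpha_1 \leq \cdots \leq \alpha_d$ of $f$ and $\beta_1 \leq \cdots \leq \beta_{d-1}$ of $g$ (counted with multiplicity), we write $g \preceq f$ ("$g$ interlaces $f$") if $$\alpha_1 \leq \beta_1 \leq \alpha_2 \leq \cdots \leq \beta_{d-1} \leq \alpha_d,$$ and $g \prec f$ if all these inequalities are strict. The relations $g \preceq f$ and $g \prec f$ include the requirement $\deg(f)=\deg(g)+1$ and that both polynomials are real-rooted.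 *)

theory Defs
  imports "HOL-Computational_Algebra.Computational_Algebra"
begin

definition diamond :: "real poly \<Rightarrow> real poly \<Rightarrow> real poly" (infixl "\<Diamond>" 70) where
  "f \<Diamond> g = (\<Sum>n\<le>degree f.
     smult (1 / fact n) ((pderiv ^^ n) f) * smult (1 / fact n) ((pderiv ^^ n) g)
       * [:0, 1:] ^ n * [:1, 1:] ^ n)"

(* The bound degree f is immaterial: all terms of larger index vanish. *)
lemma diamond_eq_sum:
  assumes "degree f \<le> N"
  shows "f \<Diamond> g = (\<Sum>n\<le>N.
     smult (1 / fact n) ((pderiv ^^ n) f) * smult (1 / fact n) ((pderiv ^^ n) g)
       * [:0, 1:] ^ n * [:1, 1:] ^ n)"
proof -
  have "(pderiv ^^ n) f = 0" if "degree f < n" for n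
    using that
  proof (induction n arbitrary: f)
    case (Suc n)
    show ?case
    proof (cases "degree f = 0")
      case True
      then have "pderiv f = 0" by (simp add: pderiv_eq_0_iff)
      then show ?thesis by (simp add: funpow_Suc_right higher_pderiv_0 del: funpow.simps)
    next
      case False
      then have "degree (pderiv f) < n" using Suc.prems by (simp add: degree_pderiv)
      then show ?thesis by (simp add: funpow_Suc_right Suc.IH del: funpow.simps)
    qed
  qed simp
  then show ?thesis
    unfolding diamond_def using assms by (intro sum.mono_neutral_left) auto
qed

lemma poly_map_poly_complex_of_real:
  "poly (map_poly complex_of_real p) (complex_of_real x) = complex_of_real (poly p x)"
  by (induction p) (simp_all add: map_poly_pCons)

lemma map_poly_complex_of_real_mult:
  "map_poly complex_of_real (p * q) = map_poly complex_of_real p * map_poly complex_of_real q"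
  by (rule poly_eqI) (simp add: coeff_map_poly coeff_mult)

definition real_rooted :: "real poly \<Rightarrow> bool" where
  "real_rooted p \<longleftrightarrow>
     p \<noteq> 0 \<and> (\<forall>z. poly (map_poly complex_of_real p) z = 0 \<longrightarrow> z \<in> \<real>)"

definition rooted_in :: "real set \<Rightarrow> real poly \<Rightarrow> bool" where
  "rooted_in I p \<longleftrightarrow>
     p \<noteq> 0 \<and> (\<forall>z. poly (map_poly complex_of_real p) z = 0 \<longrightarrow> z \<in> complex_of_real ` I)"

(* Simplicity is required of all complex zeros, not only of the real ones;
   rsquarefree also requires the polynomial to be nonzero. *)
definition simple_rooted :: "real poly \<Rightarrow> bool" where
  "simple_rooted p \<longleftrightarrow> rsquarefree (map_poly complex_of_real p)"

(* The real zeros with multiplicity, in increasing order and indexed from 0; for a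
   real-rooted polynomial these are all of its zeros. *)
definition zeros :: "real poly \<Rightarrow> real list" where
  "zeros p = sorted_list_of_multiset (proots p)"

lemma length_zeros:
  assumes "real_rooted p"
  shows "length (zeros p) = degree p"
proof -
  have "size (proots p) = degree p"
    using assms
  proof (induction "degree p" arbitrary: p)
    case 0
    then show ?case using size_proots_le[of p] by simp
  next
    case (Suc d)
    let ?c = "map_poly complex_of_real :: real poly \<Rightarrow> complex poly"
    have "\<not> constant (poly (?c p))"
      using Suc.hyps(2) by (simp add: constant_degree degree_map_poly)
    then obtain z where z: "poly (?c p) z = 0"
      using fundamental_theorem_of_algebra by blast
    then obtain x where "z = complex_of_real x"
      using Suc.prems by (auto simp: real_rooted_def elim: Reals_cases)
    with z have "poly p x = 0" by (simp add: poly_map_poly_complex_of_real)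
    then obtain q where q: "p = [:- x, 1:] * q" by (auto simp: poly_eq_0_iff_dvd)
    have "q \<noteq> 0" using Suc.prems q by (auto simp: real_rooted_def)
    then have deg: "degree p = Suc (degree q)" using q by (simp add: degree_mult_eq del: mult_pCons_left)
    have "real_rooted q"
      using Suc.prems \<open>q \<noteq> 0\<close> unfolding real_rooted_def q
      by (auto simp: map_poly_complex_of_real_mult simp del: mult_pCons_left)
    then have "size (proots q) = degree q" using Suc deg by simp
    moreover have "proots p = proots [:- x, 1:] + proots q"
      unfolding q using \<open>q \<noteq> 0\<close> by (subst proots_mult) auto
    ultimately show ?case using deg by simp
  qed
  then show ?thesis by (metis mset_sorted_list_of_multiset size_mset zeros_def)
qed

definition interlaces :: "real poly \<Rightarrow> real poly \<Rightarrow> bool" where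
  "interlaces g f \<longleftrightarrow>
     real_rooted g \<and> real_rooted f \<and> degree f = degree g + 1 \<and>
     (\<forall>i < degree g. zeros f ! i \<le> zeros g ! i \<and> zeros g ! i \<le> zeros f ! (i + 1))"

definition strictly_interlaces :: "real poly \<Rightarrow> real poly \<Rightarrow> bool" where
  "strictly_interlaces g f \<longleftrightarrow>
     real_rooted g \<and> real_rooted f \<and> degree f = degree g + 1 \<and>
     (\<forall>i < degree g. zeros f ! i < zeros g ! i \<and> zeros g ! i < zeros f ! (i + 1))"

end

(* If f has leading coefficient a and zeros \<alpha>_1, ..., \<alpha>_d, and h has zeros \<beta>_1, ..., \<beta>_e, then
   (f \<Diamond> h)(z) = a h(z) e_d(z - \<alpha>_1, ..., z - \<alpha>_d, w/(z - \<beta>_1), ..., w/(z - \<beta>_e)),  w = z(z + 1),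
   with e_d the elementary symmetric polynomial.  For z in the open upper half-plane and zeros \<beta>_j
   in [-1, 0] all arguments lie in the open or closed upper half-plane, where e_d does not vanish:
   e_{k+1}/e_k has positive imaginary part, by induction on k.  The same holds for complex f without
   zeros in the open upper half-plane.

   Up to a real factor, g interlaces f iff f/g maps the open upper half-plane into itself, because
   the argument of f/g is an alternating sum of the angles at which z is seen from the zeros, and
   near a real point x it counts the zeros beyond x.  Hence f + \<zeta> g has no zeros in the open upper
   half-plane when Im \<zeta> \<ge> 0, so neither has f \<Diamond> h + \<zeta> (g \<Diamond> h), and g \<Diamond> h interlaces f \<Diamond> h.
   In the strict case f + i g has no real zeros either, and then e_d still does not vanish for real
   z (at a simple zero \<beta>_j of h the factor z - \<beta>_j is absorbed, leaving w times the product of the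
   other factors of h and e_{d-1} of the other arguments); so f \<Diamond> h and g \<Diamond> h
   have no common zero.  Taking g = f' shows that f \<Diamond> h is simple-rooted. *)
theory Submission
  imports Defs "HOL-Analysis.Analysis"
begin

text \<open>Taylor expansion at z: shifting commutes with differentiation, and the constant
  coefficient of a shifted polynomial is its value at z. This lets the diamond product be evaluated
  from Taylor coefficients.\<close>

lemma coeff_pcompose_shift:
  fixes p :: "'a :: field_char_0 poly"
  shows "coeff (p \<circ>\<^sub>p [:z, 1:]) n = poly ((pderiv ^^ n) p) z / fact n"
proof -
  have shift: "(pderiv ^^ n) (p \<circ>\<^sub>p [:z, 1:]) = (pderiv ^^ n) p \<circ>\<^sub>p [:z, 1:]"
    by (induction n) (simp_all add: pderiv_pcompose pderiv_pCons)
  have "fact n * coeff (p \<circ>\<^sub>p [:z, 1:]) n = coeff ((pderiv ^^ n) (p \<circ>\<^sub>p [:z, 1:])) 0"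
    by (simp add: coeff_higher_pderiv pochhammer_fact)
  also have "\<dots> = poly ((pderiv ^^ n) p) z"
    by (simp add: shift poly_0_coeff_0[symmetric] poly_pcompose)
  finally show ?thesis by (simp add: field_simps)
qed

section \<open>Elementary symmetric polynomials in the upper half-plane\<close>

text \<open>Elementary symmetric polynomials, encoded by their generating function: splitting off a
  factor and differentiating the product then yield the two recursions below.\<close>

definition esym :: "'a set \<Rightarrow> ('a \<Rightarrow> 'b::comm_ring_1) \<Rightarrow> nat \<Rightarrow> 'b" where
  "esym I u k = coeff (\<Prod>i\<in>I. [:1, u i:]) k"

lemma esym_0 [simp]: "esym I u 0 = 1"
  by (simp add: esym_def poly_0_coeff_0[symmetric] poly_prod)

lemma esym_remove:
  assumes "finite I" "i \<in> I"
  shows "esym I u (Suc k) = esym (I - {i}) u (Suc k) + u i * esym (I - {i}) u k"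
  unfolding esym_def prod.remove[OF assms] by simp

text \<open>Compare coefficients in the product rule for the derivative of the generating
  function.\<close>

lemma esym_Suc:
  fixes u :: "'a \<Rightarrow> 'b::idom"
  shows "of_nat (Suc k) * esym I u (Suc k) = (\<Sum>i\<in>I. u i * esym (I - {i}) u k)"
proof -
  have "of_nat (Suc k) * esym I u (Suc k) = coeff (pderiv (\<Prod>i\<in>I. [:1, u i:])) k"
    by (simp add: esym_def coeff_pderiv)
  also have "\<dots> = (\<Sum>i\<in>I. u i * esym (I - {i}) u k)"
    unfolding pderiv_prod by (simp add: coeff_sum esym_def pderiv_pCons mult.commute)
  finally show ?thesis .
qed

text \<open>For nonzero u the expression is the reciprocal of 1/u + 1/r, and inversion exchanges the
  two half-planes. The undivided form also covers u = 0.\<close>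

lemma Im_parallel_sum_nonneg:
  assumes "Im u \<ge> 0" "Im r > 0"
  shows "Im (u * r / (r + u)) \<ge> 0" and "Im u > 0 \<Longrightarrow> Im (u * r / (r + u)) > 0"
proof -
  have "Im (r + u) > 0" using assms by simp
  then have nz: "r + u \<noteq> 0" by force
  have eq: "Im (u * r / (r + u)) = (Im u * (cmod r)\<^sup>2 + Im r * (cmod u)\<^sup>2) / (cmod (r + u))\<^sup>2"
    unfolding Im_divide cmod_power2 by (simp add: power2_eq_square algebra_simps)
  have "r \<noteq> 0" using assms by force
  show "Im (u * r / (r + u)) \<ge> 0" unfolding eq using assms by simp
  show "Im (u * r / (r + u)) > 0" if "Im u > 0"
    unfolding eq using that nz \<open>r \<noteq> 0\<close> assms by (intro divide_pos_pos add_pos_nonneg mult_pos_pos) auto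
qed

text \<open>Induction on k for all index sets at once: the next ratio is, up to a positive factor,
  the sum of the terms u_i r_i / (r_i + u_i), where r_i is the previous ratio with index i left out.
  Leaving out an index costs at most one argument in the open half-plane, so the induction
  hypothesis still applies.\<close>

lemma esym_ratio_upper_half_plane:
  fixes u :: "'a \<Rightarrow> complex"
  assumes "finite I" "\<And>i. i \<in> I \<Longrightarrow> Im (u i) \<ge> 0" "k < card {i\<in>I. Im (u i) > 0}"
  shows "Im (esym I u (Suc k) / esym I u k) > 0"
  using assms
proof (induction k arbitrary: I)
  case 0
  then obtain i where "i \<in> I" "Im (u i) > 0"
    by (metis (mono_tags, lifting) card.empty equals0I less_irrefl mem_Collect_eq)
  then have "(\<Sum>i\<in>I. Im (u i)) > 0"
    using 0 by (intro sum_pos2) auto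
  then show ?case
    using esym_Suc[of 0 I u] by simp
next
  case (Suc k)
  let ?e = "esym I u (Suc k)"
  define r where "r i = esym (I - {i}) u (Suc k) / esym (I - {i}) u k" for i
  have nz: "?e \<noteq> 0"
    using Suc.IH[of I] Suc.prems by force
  have r: "Im (r i) > 0" if "i \<in> I" for i
    unfolding r_def
  proof (rule Suc.IH)
    have "card {j\<in>I. Im (u j) > 0} \<le> card (insert i {j\<in>I - {i}. Im (u j) > 0})"
      using Suc.prems by (intro card_mono) auto
    also have "\<dots> = Suc (card {j\<in>I - {i}. Im (u j) > 0})"
      using Suc.prems by (intro card_insert_disjoint) auto
    finally show "k < card {j\<in>I - {i}. Im (u j) > 0}" using Suc.prems by simp
  qed (use Suc.prems in auto)
  have summand: "u i * esym (I - {i}) u (Suc k) / ?e = u i * r i / (r i + u i)" if "i \<in> I" for i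
  proof -
    \<comment> \<open>A zero denominator would make the quotient \<open>r i\<close> equal to 0 by
      convention, against its positive imaginary part.\<close>
    have "esym (I - {i}) u k \<noteq> 0" using r[OF that] by (auto simp: r_def)
    then show ?thesis
      unfolding esym_remove[OF Suc.prems(1) that] r_def by (simp add: divide_simps)
  qed
  have "of_nat (Suc (Suc k)) * (esym I u (Suc (Suc k)) / ?e) = (\<Sum>i\<in>I. u i * r i / (r i + u i))"
    unfolding times_divide_eq_right esym_Suc sum_divide_distrib by (intro sum.cong refl summand)
  from arg_cong[OF this, of Im] have "real (Suc (Suc k)) * Im (esym I u (Suc (Suc k)) / ?e) =
      (\<Sum>i\<in>I. Im (u i * r i / (r i + u i)))"
    by (simp only: Im_sum times_complex.sel complex_Re_of_nat complex_Im_of_nat mult_zero_left add_0_right)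
  moreover have "\<dots> > 0"
  proof -
    obtain i where "i \<in> I" "Im (u i) > 0"
      using Suc.prems(3) by (metis (mono_tags, lifting) card.empty equals0I not_less_zero mem_Collect_eq)
    then show ?thesis
      using Suc.prems r Im_parallel_sum_nonneg by (intro sum_pos2[of I i]) auto
  qed
  ultimately show ?case
    by (metis of_nat_0_less_iff zero_less_Suc zero_less_mult_pos)
qed

lemma esym_nonzero:
  fixes u :: "'a \<Rightarrow> complex"
  assumes "finite I" "\<And>i. i \<in> I \<Longrightarrow> Im (u i) \<ge> 0" "k \<le> card {i\<in>I. Im (u i) > 0}"
  shows "esym I u k \<noteq> 0"
proof (cases k)
  case (Suc m)
  then show ?thesis using esym_ratio_upper_half_plane[of I u m] assms by force
qed simp

section \<open>Evaluating the diamond product at a complex point\<close>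

abbreviation cpoly :: "real poly \<Rightarrow> complex poly" where
  "cpoly \<equiv> map_poly complex_of_real"

lemma cpoly_smult: "cpoly (smult c p) = smult (of_real c) (cpoly p)"
  by (rule poly_eqI) (simp add: coeff_map_poly)

lemma cpoly_sum: "cpoly (\<Sum>i\<in>A. p i) = (\<Sum>i\<in>A. cpoly (p i))"
  by (rule poly_eqI) (simp add: coeff_map_poly coeff_sum)

lemma cpoly_power: "cpoly (p ^ n) = cpoly p ^ n"
  by (induction n) (simp_all add: map_poly_complex_of_real_mult)

lemma cpoly_prod: "cpoly (\<Prod>i\<in>A. p i) = (\<Prod>i\<in>A. cpoly (p i))"
  by (induction A rule: infinite_finite_induct) (simp_all add: map_poly_complex_of_real_mult)

lemma cpoly_pderiv: "cpoly (pderiv p) = pderiv (cpoly p)"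
  by (rule poly_eqI) (simp add: coeff_map_poly coeff_pderiv)

lemma cpoly_higher_pderiv: "cpoly ((pderiv ^^ n) p) = (pderiv ^^ n) (cpoly p)"
  by (induction n) (simp_all add: cpoly_pderiv)

lemma degree_cpoly [simp]: "degree (cpoly p) = degree p"
  by (simp add: degree_map_poly)

lemma cpoly_inject: "cpoly p = cpoly q \<longleftrightarrow> p = q"
  by (simp add: poly_eq_iff coeff_map_poly)

lemma cpoly_eq_0_iff [simp]: "cpoly p = 0 \<longleftrightarrow> p = 0"
  by (simp add: map_poly_eq_0_iff)

definition diamond_at :: "complex poly \<Rightarrow> complex poly \<Rightarrow> complex \<Rightarrow> complex" where
  "diamond_at p q z =
     (\<Sum>n\<le>degree p. coeff (p \<circ>\<^sub>p [:z, 1:]) n * coeff (q \<circ>\<^sub>p [:z, 1:]) n * (z * (z + 1)) ^ n)"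

lemma diamond_at_eq_sum:
  assumes "degree p \<le> N"
  shows "diamond_at p q z =
     (\<Sum>n\<le>N. coeff (p \<circ>\<^sub>p [:z, 1:]) n * coeff (q \<circ>\<^sub>p [:z, 1:]) n * (z * (z + 1)) ^ n)"
  unfolding diamond_at_def using assms
  by (intro sum.mono_neutral_left) (auto simp: coeff_eq_0 degree_pcompose)

lemma diamond_at_add_smult:
  "diamond_at (p + smult c r) q z = diamond_at p q z + c * diamond_at r q z"
proof -
  define N where "N = max (degree p) (degree r)"
  have "degree p \<le> N" "degree r \<le> N" by (auto simp: N_def)
  moreover have "degree (p + smult c r) \<le> N"
    using calculation by (meson degree_add_le degree_smult_le order_trans)
  ultimately show ?thesis
    by (simp add: diamond_at_eq_sum[of _ N] pcompose_add pcompose_smult sum_distrib_left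
        sum.distrib algebra_simps)
qed

lemma poly_cpoly_diamond: "poly (cpoly (f \<Diamond> h)) z = diamond_at (cpoly f) (cpoly h) z"
  unfolding diamond_def diamond_at_def cpoly_sum poly_sum
  by (simp add: map_poly_complex_of_real_mult cpoly_smult cpoly_power cpoly_higher_pderiv
      map_poly_pCons coeff_pcompose_shift power_mult_distrib mult_ac add.commute)

text \<open>Reversing the coefficients of X + u gives 1 + u X, and reversal is
  multiplicative.\<close>

lemma coeff_prod_monic_linear:
  fixes u :: "'a \<Rightarrow> complex"
  assumes "finite I" "k \<le> card I"
  shows "coeff (\<Prod>i\<in>I. [:u i, 1:]) (card I - k) = esym I u k"
proof -
  have "reflect_poly [:u i, 1:] = [:1, u i:]" for i
    by (cases "u i = 0") (simp_all add: reflect_poly_pCons reflect_poly_pCons')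
  then have "(\<Prod>i\<in>I. [:1, u i:]) = reflect_poly (\<Prod>i\<in>I. [:u i, 1:])"
    by (simp add: reflect_poly_prod)
  moreover have "degree (\<Prod>i\<in>I. [:u i, 1:]) = card I"
    by (subst degree_prod_eq_sum_degree) auto
  ultimately show ?thesis
    using assms by (simp add: esym_def coeff_reflect_poly)
qed

text \<open>The sum is a Cauchy product: reversal turns the Taylor coefficient of p at n into one at
  d - n, and the power of w is absorbed by rescaling the variable in the factors of q. The factors z
  - \<beta>_j are not divided out, so the formula remains valid at zeros of q.\<close>

lemma diamond_at_prod:
  fixes \<alpha> \<beta> :: "nat \<Rightarrow> complex"
  assumes p: "p = smult a (\<Prod>i<d. [:- \<alpha> i, 1:])" and q: "q = smult b (\<Prod>j<e. [:- \<beta> j, 1:])"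
    and "a \<noteq> 0"
  shows "diamond_at p q z = a * b *
    coeff ((\<Prod>i<d. [:1, z - \<alpha> i:]) * (\<Prod>j<e. [:z - \<beta> j, z * (z + 1):])) d"
proof -
  let ?w = "z * (z + 1)"
  have "degree p = d"
    unfolding p using \<open>a \<noteq> 0\<close> by (simp add: degree_prod_eq_sum_degree)
  have P: "p \<circ>\<^sub>p [:z, 1:] = smult a (\<Prod>i<d. [:z - \<alpha> i, 1:])"
    unfolding p pcompose_smult pcompose_prod by (simp add: pcompose_pCons)
  have Q: "q \<circ>\<^sub>p [:z, 1:] = smult b (\<Prod>j<e. [:z - \<beta> j, 1:])"
    unfolding q pcompose_smult pcompose_prod by (simp add: pcompose_pCons)
  have W: "(\<Prod>j<e. [:z - \<beta> j, ?w:]) = (\<Prod>j<e. [:z - \<beta> j, 1:]) \<circ>\<^sub>p [:0, ?w:]"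
    unfolding pcompose_prod by (simp add: pcompose_pCons)
  have "diamond_at p q z = (\<Sum>n\<le>d. a * b *
      (coeff (\<Prod>j<e. [:z - \<beta> j, ?w:]) n * coeff (\<Prod>i<d. [:1, z - \<alpha> i:]) (d - n)))"
    unfolding diamond_at_def \<open>degree p = d\<close>
  proof (intro sum.cong refl)
    fix n assume "n \<in> {..d}"
    then have "coeff (\<Prod>i<d. [:z - \<alpha> i, 1:]) n = coeff (\<Prod>i<d. [:1, z - \<alpha> i:]) (d - n)"
      using coeff_prod_monic_linear[of "{..<d}" "d - n" "\<lambda>i. z - \<alpha> i"] by (simp add: esym_def)
    then show "coeff (p \<circ>\<^sub>p [:z, 1:]) n * coeff (q \<circ>\<^sub>p [:z, 1:]) n * ?w ^ n = a * b *
      (coeff (\<Prod>j<e. [:z - \<beta> j, ?w:]) n * coeff (\<Prod>i<d. [:1, z - \<alpha> i:]) (d - n))"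
      unfolding P Q W by (simp add: coeff_pcompose_linear)
  qed
  also have "\<dots> = a * b *
    coeff ((\<Prod>i<d. [:1, z - \<alpha> i:]) * (\<Prod>j<e. [:z - \<beta> j, ?w:])) d"
    unfolding sum_distrib_left[symmetric] by (subst mult.commute[of "\<Prod>i<d. _ i"]) (simp add: coeff_mult)
  finally show ?thesis .
qed

lemma coeff_prod_linear_nonzero:
  fixes u c :: "nat \<Rightarrow> complex"
  assumes "finite I" "finite J" "k \<le> card I"
    and "\<And>i. i \<in> I \<Longrightarrow> Im (u i) > 0"
    and "\<And>j. j \<in> J \<Longrightarrow> c j \<noteq> 0 \<and> Im (w / c j) \<ge> 0"
  shows "coeff ((\<Prod>i\<in>I. [:1, u i:]) * (\<Prod>j\<in>J. [:c j, w:])) k \<noteq> 0"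
proof -
  \<comment> \<open>Both families become one family on the disjoint union \<open>I <+> J\<close>,
    once each c_j is factored out.\<close>
  define v where "v = case_sum u (\<lambda>j. w / c j)"
  have "[:c j, w:] = smult (c j) [:1, w / c j:]" if "j \<in> J" for j
    using assms(5)[OF that] by simp
  then have "(\<Prod>j\<in>J. [:c j, w:]) = (\<Prod>j\<in>J. smult (c j) [:1, w / c j:])"
    by (intro prod.cong) auto
  also have "\<dots> = smult (\<Prod>j\<in>J. c j) (\<Prod>j\<in>J. [:1, w / c j:])"
    by (rule prod_smult)
  finally have "coeff ((\<Prod>i\<in>I. [:1, u i:]) * (\<Prod>j\<in>J. [:c j, w:])) k =
      (\<Prod>j\<in>J. c j) * esym (I <+> J) v k"
    using assms by (simp add: esym_def v_def prod.Plus)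
  moreover have "card I \<le> card {i \<in> I <+> J. Im (v i) > 0}"
  proof -
    have "card I = card (Inl ` I :: (nat + nat) set)" by (simp add: card_image)
    also have "\<dots> \<le> card {i \<in> I <+> J. Im (v i) > 0}"
      using assms by (intro card_mono) (auto simp: v_def)
    finally show ?thesis .
  qed
  then have "esym (I <+> J) v k \<noteq> 0"
    using assms by (intro esym_nonzero) (auto simp: v_def intro: less_imp_le)
  moreover have "(\<Prod>j\<in>J. c j) \<noteq> 0" using assms by simp
  ultimately show ?thesis by simp
qed

text \<open>Stated so as to serve both for z in the upper half-plane and for real z. The last
  hypothesis handles the case that z is itself a zero of q.\<close>

lemma diamond_at_nonzero:
  assumes "p \<noteq> 0" "q \<noteq> 0"
    and p: "\<And>x. poly p x = 0 \<Longrightarrow> Im x < Im z"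
    and q: "\<And>x. poly q x = 0 \<Longrightarrow> x \<noteq> z \<Longrightarrow> Im (z * (z + 1) / (z - x)) \<ge> 0"
    and qz: "poly q z = 0 \<Longrightarrow> degree p > 0 \<and> order z q = 1 \<and> z * (z + 1) \<noteq> 0"
  shows "diamond_at p q z \<noteq> 0"
proof -
  define d where "d = degree p"
  define e where "e = degree q"
  define w where "w = z * (z + 1)"
  obtain \<alpha> where \<alpha>: "smult (lead_coeff p) (\<Prod>i<d. [:-\<alpha> i, 1:]) = p"
    unfolding d_def by (rule complex_poly_decompose')
  obtain \<beta> where \<beta>: "smult (lead_coeff q) (\<Prod>i<e. [:-\<beta> i, 1:]) = q"
    unfolding e_def by (rule complex_poly_decompose')
  have lc: "lead_coeff p \<noteq> 0" "lead_coeff q \<noteq> 0" using assms by auto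
  have "poly p (\<alpha> i) = 0" if "i < d" for i
    by (subst \<alpha>[symmetric]) (use that in \<open>auto simp: poly_prod\<close>)
  then have u: "Im (z - \<alpha> i) > 0" if "i < d" for i using p that by force
  have root: "poly q (\<beta> j) = 0" if "j < e" for j
    by (subst \<beta>[symmetric]) (use that in \<open>auto simp: poly_prod\<close>)
  have v: "Im (w / (z - \<beta> j)) \<ge> 0" if "j < e" "\<beta> j \<noteq> z" for j
    using q[OF root] that by (simp add: w_def)
  have "coeff ((\<Prod>i<d. [:1, z - \<alpha> i:]) * (\<Prod>j<e. [:z - \<beta> j, w:])) d \<noteq> 0"
  proof (cases "\<exists>k<e. \<beta> k = z")
    case False
    then show ?thesis
      using u v by (intro coeff_prod_linear_nonzero) auto
  next
    case True
    then obtain k where k: "k < e" "\<beta> k = z" by blast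
    with root have "poly q z = 0" by blast
    note qz = qz[OF this]
    \<comment> \<open>A second vanishing factor would make z a zero of order at least 2.\<close>
    have other: "\<beta> j \<noteq> z" if "j < e" "j \<noteq> k" for j
    proof
      assume j: "\<beta> j = z"
      have "[:-z, 1:] ^ 2 dvd (\<Prod>i\<in>{j,k}. [:-\<beta> i, 1:])"
        using that k j by (simp add: power2_eq_square del: mult_pCons_left mult_pCons_right)
      also have "\<dots> dvd (\<Prod>i<e. [:-\<beta> i, 1:])"
        using that k by (intro prod_dvd_prod_subset) auto
      also have "\<dots> dvd q" by (metis \<beta> dvd_refl dvd_smult)
      finally have "2 \<le> order z q" using \<open>q \<noteq> 0\<close> by (simp add: order_divides)
      with qz show False by simp
    qed
    obtain d' where d': "d = Suc d'" using qz by (auto simp: d_def gr0_conv_Suc)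
    \<comment> \<open>The factor belonging to z degenerates to w X, so the coefficient at d is w
      times the coefficient at d - 1 of the remaining product.\<close>
    have "(\<Prod>j<e. [:z - \<beta> j, w:]) = [:0, w:] * (\<Prod>j\<in>{..<e} - {k}. [:z - \<beta> j, w:])"
      using k by (subst prod.remove[of _ k]) auto
    then have "(\<Prod>i<d. [:1, z - \<alpha> i:]) * (\<Prod>j<e. [:z - \<beta> j, w:]) =
       pCons 0 (smult w ((\<Prod>i<d. [:1, z - \<alpha> i:]) * (\<Prod>j\<in>{..<e} - {k}. [:z - \<beta> j, w:])))"
      by simp
    moreover have "coeff ((\<Prod>i<d. [:1, z - \<alpha> i:]) * (\<Prod>j\<in>{..<e} - {k}. [:z - \<beta> j, w:])) d' \<noteq> 0"
      using u v d' other by (intro coeff_prod_linear_nonzero) auto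
    ultimately show ?thesis using qz d' by (simp add: w_def)
  qed
  then show ?thesis
    using diamond_at_prod[OF \<alpha>[symmetric] \<beta>[symmetric] lc(1)] lc by (simp add: w_def)
qed

text \<open>Division with remainder gives z + 1 + x + x (x + 1) / (z - x). On [-1, 0] the number x
  (x + 1) is not positive, which compensates the sign of the imaginary part of 1 / (z - x).\<close>

lemma Im_diamond_weight_nonneg:
  assumes "Im z \<ge> 0" "x \<in> {-1..0}" "z \<noteq> complex_of_real x"
  shows "Im (z * (z + 1) / (z - of_real x)) \<ge> 0"
proof -
  have "z * (z + 1) / (z - of_real x) = z + 1 + of_real x + of_real (x * (x + 1)) / (z - of_real x)"
    using assms by (simp add: field_simps)
  moreover have "Im (of_real (x * (x + 1)) / (z - of_real x)) \<ge> 0"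
    using assms by (auto simp: Im_divide intro!: divide_nonpos_nonneg mult_nonneg_nonneg mult_nonpos_nonneg)
  ultimately show ?thesis using assms by simp
qed

section \<open>Interlacing and the argument of a quotient\<close>

lemma cis_sum: "cis (\<Sum>i\<in>A. f i) = (\<Prod>i\<in>A. cis (f i))"
  by (induction A rule: infinite_finite_induct) (simp_all add: cis_mult[symmetric])

text \<open>For \<open>Im z > 0\<close> this is the argument of \<open>z - a\<close> in \<open>(0, \<pi>)\<close>.\<close>
definition angle :: "complex \<Rightarrow> real \<Rightarrow> real" where
  "angle z a = pi / 2 - arctan ((Re z - a) / Im z)"

lemma angle_polar:
  assumes "Im z > 0"
  shows "z - of_real a = of_real (cmod (z - of_real a)) * cis (angle z a)"
proof -
  \<comment> \<open>The cotangent of the angle; its sine is therefore 1 / sqrt (1 + r^2).\<close>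
  define r where "r = (Re z - a) / Im z"
  have "cmod (z - of_real a) = sqrt ((Im z)\<^sup>2 * (1 + r\<^sup>2))"
    using assms by (simp add: cmod_def r_def field_simps)
  also have "\<dots> = Im z * sqrt (1 + r\<^sup>2)"
    using assms by (simp add: real_sqrt_mult)
  finally have norm: "cmod (z - of_real a) = Im z * sqrt (1 + r\<^sup>2)" .
  have "1 + r\<^sup>2 > 0" by (simp add: add_pos_nonneg)
  then have "sqrt (1 + r\<^sup>2) \<noteq> 0" by simp
  moreover have "Im z * r = Re z - a" using assms by (simp add: r_def)
  ultimately show ?thesis
    by (simp add: complex_eq_iff norm angle_def r_def[symmetric] cos_diff sin_diff cos_arctan sin_arctan)
qed

lemma angle_gt_0: "angle z a > 0"
  using arctan_ubound[of "(Re z - a) / Im z"] by (simp add: angle_def)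

lemma angle_less_pi: "angle z a < pi"
  using arctan_lbound[of "(Re z - a) / Im z"] by (simp add: angle_def)

lemma angle_mono: "Im z > 0 \<Longrightarrow> a \<le> b \<Longrightarrow> angle z a \<le> angle z b"
  by (simp add: angle_def arctan_le_iff divide_right_mono)

text \<open>Factor over the complex numbers, observe that all zeros are real, and match them with
  the sorted list through the multiset \<open>proots p\<close>. This connects the list in the
  definition of interlacing with values of p.\<close>

lemma real_rooted_factorization:
  assumes "real_rooted p"
  shows "p = smult (lead_coeff p) (\<Prod>i<degree p. [:- zeros p ! i, 1:])"
proof -
  define d where "d = degree p"
  obtain \<gamma> where \<gamma>: "smult (lead_coeff (cpoly p)) (\<Prod>i<d. [:- \<gamma> i, 1:]) = cpoly p"
    using complex_poly_decompose'[of "cpoly p"] by (auto simp: d_def)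
  have "poly (cpoly p) (\<gamma> i) = 0" if "i < d" for i
    by (subst \<gamma>[symmetric]) (use that in \<open>auto simp: poly_prod\<close>)
  then have "\<gamma> i \<in> \<real>" if "i < d" for i
    using assms that by (auto simp: real_rooted_def)
  then have re: "\<gamma> i = of_real (Re (\<gamma> i))" if "i < d" for i
    using that by simp
  define r where "r i = Re (\<gamma> i)" for i
  have "(\<Prod>i<d. [:- \<gamma> i, 1:]) = cpoly (\<Prod>i<d. [:- r i, 1:])"
    unfolding cpoly_prod r_def by (intro prod.cong refl) (use re in \<open>simp add: map_poly_pCons\<close>)
  then have "cpoly p = cpoly (smult (lead_coeff p) (\<Prod>i<d. [:- r i, 1:]))"
    using \<gamma> by (simp add: cpoly_smult coeff_map_poly)
  then have eq: "p = smult (lead_coeff p) (\<Prod>i<d. [:- r i, 1:])"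
    by (metis cpoly_inject)
  have "lead_coeff p \<noteq> 0" using assms by (simp add: real_rooted_def)
  then have "proots p = proots (\<Prod>i<d. [:- r i, 1:])"
    by (subst eq) (rule proots_smult)
  also have "\<dots> = (\<Sum>i<d. {#r i#})"
    by (subst proots_prod) simp_all
  finally have proots: "proots p = (\<Sum>i<d. {#r i#})" .
  have "(\<Prod>i<d. [:- r i, 1:]) = (\<Prod>x\<in>#(\<Sum>i<d. {#r i#}). [:- x, 1:])"
    by (induction d) (simp_all add: mult.commute)
  also have "\<dots> = (\<Prod>x\<leftarrow>zeros p. [:- x, 1:])"
    by (metis proots zeros_def mset_map mset_sorted_list_of_multiset prod_mset_prod_list)
  also have "\<dots> = (\<Prod>i<d. [:- zeros p ! i, 1:])"
    using length_zeros[OF assms] by (simp add: prod.list_conv_set_nth atLeast0LessThan d_def)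
  finally show ?thesis using eq by (simp add: d_def)
qed

text \<open>For real-rooted p and Im z > 0, an argument of p(z) divided by the leading coefficient.
  It is a real number, not a class modulo 2 pi, so that it is continuous and can count
  zeros.\<close>

definition phase :: "real poly \<Rightarrow> complex \<Rightarrow> real" where
  "phase p z = (\<Sum>i<degree p. angle z (zeros p ! i))"

lemma real_rooted_polar:
  assumes "real_rooted p" "Im z > 0"
  obtains R where "R > 0" "poly (cpoly p) z = of_real (lead_coeff p * R) * cis (phase p z)"
proof
  let ?R = "\<Prod>i<degree p. cmod (z - of_real (zeros p ! i))"
  show "?R > 0"
    using assms by (intro prod_pos) auto
  have "cpoly p = smult (of_real (lead_coeff p)) (\<Prod>i<degree p. [:- of_real (zeros p ! i), 1:])"
    by (subst (1) real_rooted_factorization[OF assms(1)]) (simp add: cpoly_smult cpoly_prod map_poly_pCons)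
  then have "poly (cpoly p) z = of_real (lead_coeff p) * (\<Prod>i<degree p. z - of_real (zeros p ! i))"
    by (simp add: poly_prod)
  also have "(\<Prod>i<degree p. z - of_real (zeros p ! i)) =
      (\<Prod>i<degree p. of_real (cmod (z - of_real (zeros p ! i))) * cis (angle z (zeros p ! i)))"
    using angle_polar[OF assms(2)] by (intro prod.cong) auto
  also have "\<dots> = of_real ?R * cis (phase p z)"
    unfolding phase_def prod.distrib by (simp add: of_real_prod cis_sum)
  finally show "poly (cpoly p) z = of_real (lead_coeff p * ?R) * cis (phase p z)" by simp
qed

lemma Im_quotient_pos_iff:
  assumes "real_rooted f" "real_rooted g" "lead_coeff f / lead_coeff g > 0" "Im z > 0"
  shows "Im (poly (cpoly f) z / poly (cpoly g) z) > 0 \<longleftrightarrow> sin (phase f z - phase g z) > 0"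
proof -
  obtain R where R: "R > 0" "poly (cpoly f) z = of_real (lead_coeff f * R) * cis (phase f z)"
    using real_rooted_polar assms by blast
  obtain S where S: "S > 0" "poly (cpoly g) z = of_real (lead_coeff g * S) * cis (phase g z)"
    using real_rooted_polar assms by blast
  have "poly (cpoly f) z / poly (cpoly g) z =
      of_real (lead_coeff f / lead_coeff g * (R / S)) * cis (phase f z - phase g z)"
    unfolding R S by (simp add: cis_divide[symmetric])
  moreover have "lead_coeff f / lead_coeff g * (R / S) > 0"
    using assms R S by (intro mult_pos_pos) auto
  ultimately show ?thesis
    by (simp only: times_complex.sel Re_complex_of_real Im_complex_of_real cis.sel mult_zero_left add_0_right)
      (metis mult_pos_pos zero_less_mult_pos)
qed

text \<open>The alternating sum of angles is grouped in two ways. As the first angle of f plus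
  nonnegative increments it exceeds 0; as the last angle of f minus nonnegative increments it stays
  below pi.\<close>

lemma interlaces_imp_Im_quotient_pos:
  assumes "interlaces g f" "lead_coeff f / lead_coeff g > 0" "Im z > 0"
  shows "Im (poly (cpoly f) z / poly (cpoly g) z) > 0"
proof -
  define n where "n = degree g"
  let ?a = "\<lambda>i. angle z (zeros f ! i)" and ?b = "\<lambda>i. angle z (zeros g ! i)"
  have il: "zeros f ! i \<le> zeros g ! i" "zeros g ! i \<le> zeros f ! Suc i" if "i < n" for i
    using assms(1) that by (auto simp: interlaces_def n_def)
  have deg: "degree f = Suc n" using assms(1) by (simp add: interlaces_def n_def)
  have "phase f z - phase g z = ?a 0 + (\<Sum>i<n. ?a (Suc i) - ?b i)"
    unfolding phase_def deg n_def[symmetric] by (subst sum.lessThan_Suc_shift) (simp add: sum_subtractf)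
  moreover have "(\<Sum>i<n. ?a (Suc i) - ?b i) \<ge> 0"
    using il angle_mono[OF assms(3)] by (intro sum_nonneg) auto
  ultimately have pos: "phase f z - phase g z > 0"
    using angle_gt_0[of z "zeros f ! 0"] by linarith
  have "phase f z - phase g z = ?a n - (\<Sum>i<n. ?b i - ?a i)"
    unfolding phase_def deg n_def[symmetric] by (simp add: sum_subtractf)
  moreover have "(\<Sum>i<n. ?b i - ?a i) \<ge> 0"
    using il angle_mono[OF assms(3)] by (intro sum_nonneg) auto
  ultimately have "phase f z - phase g z < pi"
    using angle_less_pi[of z "zeros f ! n"] by linarith
  with pos show ?thesis
    using assms by (subst Im_quotient_pos_iff) (auto simp: interlaces_def intro: sin_gt_zero)
qed

section \<open>Limits of phases, and interlacing recovered from the quotient\<close>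

lemma tendsto_angle_at_top: "((\<lambda>x. angle (Complex x 1) a) \<longlongrightarrow> 0) at_top"
proof -
  have "filterlim (\<lambda>x::real. x - a) at_top at_top"
    using filterlim_tendsto_add_at_top[OF tendsto_const[of "- a"] filterlim_ident] by simp
  then have "((\<lambda>x. arctan (x - a)) \<longlongrightarrow> pi / 2) at_top"
    by (rule filterlim_compose[OF tendsto_arctan_at_top])
  from tendsto_diff[OF tendsto_const[of "pi / 2"] this] show ?thesis
    by (simp add: angle_def)
qed

lemma tendsto_angle_boundary:
  assumes "x \<noteq> a"
  shows "((\<lambda>y. angle (Complex x y) a) \<longlongrightarrow> (if x < a then pi else 0)) (at_right 0)"
proof -
  have inv: "filterlim (\<lambda>y::real. inverse y) at_top (at_right 0)"
    by (rule filterlim_inverse_at_top_right)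
  have angle: "angle (Complex x y) a = pi / 2 - arctan ((x - a) * inverse y)" for y
    by (simp only: angle_def complex.sel divide_inverse)
  show ?thesis
  proof (cases "x < a")
    case True
    then have "filterlim (\<lambda>y. (x - a) * inverse y) at_bot (at_right 0)"
      by (intro filterlim_tendsto_neg_mult_at_bot[OF tendsto_const _ inv]) auto
    then have "((\<lambda>y. arctan ((x - a) * inverse y)) \<longlongrightarrow> - (pi / 2)) (at_right 0)"
      by (rule filterlim_compose[OF tendsto_arctan_at_bot])
    from tendsto_diff[OF tendsto_const[of "pi / 2"] this] show ?thesis
      using True by (simp add: angle)
  next
    case False
    with assms have "filterlim (\<lambda>y. (x - a) * inverse y) at_top (at_right 0)"
      by (intro filterlim_tendsto_pos_mult_at_top[OF tendsto_const _ inv]) auto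
    then have "((\<lambda>y. arctan ((x - a) * inverse y)) \<longlongrightarrow> pi / 2) (at_right 0)"
      by (rule filterlim_compose[OF tendsto_arctan_at_top])
    from tendsto_diff[OF tendsto_const[of "pi / 2"] this] show ?thesis
      using False by (simp add: angle)
  qed
qed

lemma tendsto_phase_boundary:
  assumes "\<And>i. i < degree p \<Longrightarrow> zeros p ! i \<noteq> x"
  shows "((\<lambda>y. phase p (Complex x y)) \<longlongrightarrow> pi * card {i. i < degree p \<and> x < zeros p ! i}) (at_right 0)"
proof -
  have "((\<lambda>y. phase p (Complex x y)) \<longlongrightarrow>
      (\<Sum>i<degree p. if x < zeros p ! i then pi else 0)) (at_right 0)"
    unfolding phase_def using assms by (intro tendsto_sum tendsto_angle_boundary) (metis lessThan_iff)
  moreover have "(\<Sum>i<degree p. if x < zeros p ! i then pi else 0) =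
      pi * card {i. i < degree p \<and> x < zeros p ! i}"
    by (simp add: sum.If_cases Int_def)
  ultimately show ?thesis by simp
qed

lemma continuous_on_phase: "continuous_on {z. Im z > 0} (phase p)"
  unfolding phase_def[abs_def] angle_def by (intro continuous_intros) auto

text \<open>A positive sine leaves only the intervals (2 k pi, (2 k + 1) pi). The half-plane is
  connected, so the continuous difference stays in one of them, and its limit 0 along Im z = 1
  selects k = 0.\<close>

lemma phase_difference_bounds:
  assumes sin: "\<And>z. Im z > 0 \<Longrightarrow> sin (phase f z - phase g z) > 0" and "Im z > 0"
  shows "0 < phase f z - phase g z \<and> phase f z - phase g z < pi"
proof -
  define \<Phi> where "\<Phi> z = phase f z - phase g z" for z
  define H where "H = {z. Im z > 0}"
  have "continuous_on H \<Phi>"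
    unfolding \<Phi>_def H_def by (intro continuous_intros continuous_on_phase)
  then have conn: "connected (\<Phi> ` H)"
    unfolding H_def
    by (intro connected_continuous_image convex_connected convex_halfspace_Im_gt)
  have avoid: "0 \<notin> \<Phi> ` H" "pi \<notin> \<Phi> ` H"
    using sin by (force simp: \<Phi>_def H_def)+
  have "((\<lambda>x. phase p (Complex x 1)) \<longlongrightarrow> (\<Sum>i<degree p. 0)) at_top" for p
    unfolding phase_def by (intro tendsto_sum tendsto_angle_at_top)
  then have "((\<lambda>x. \<Phi> (Complex x 1)) \<longlongrightarrow> 0 - 0) at_top"
    unfolding \<Phi>_def by (intro tendsto_diff) simp_all
  then have "\<forall>\<^sub>F x in at_top. \<bar>\<Phi> (Complex x 1)\<bar> < pi"
    using tendstoD[of "\<lambda>x. \<Phi> (Complex x 1)" 0 at_top pi] by (simp add: dist_real_def)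
  then obtain x where x: "\<bar>\<Phi> (Complex x 1)\<bar> < pi"
    using eventually_happens trivial_limit_at_top_linorder by blast
  define t where "t = \<Phi> (Complex x 1)"
  have t: "t \<in> \<Phi> ` H" by (simp add: t_def H_def)
  have "sin t > 0" using sin[of "Complex x 1"] by (simp add: t_def \<Phi>_def)
  then have "0 < t"
    using x sin_ge_zero[of "- t"] unfolding t_def by (cases "\<Phi> (Complex x 1) > 0") auto
  have "t < pi" using x by (simp add: t_def)
  have z: "\<Phi> z \<in> \<Phi> ` H" using assms by (simp add: H_def)
  have "0 < \<Phi> z"
    using connectedD_interval[OF conn z t, of 0] avoid \<open>0 < t\<close> by fastforce
  moreover have "\<Phi> z < pi"
    using connectedD_interval[OF conn t z, of pi] avoid \<open>t < pi\<close> by fastforce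
  ultimately show ?thesis by (simp add: \<Phi>_def)
qed

lemma sorted_zeros: "i \<le> j \<Longrightarrow> j < degree p \<Longrightarrow> real_rooted p \<Longrightarrow> zeros p ! i \<le> zeros p ! j"
  using length_zeros[of p] sorted_nth_mono[of "zeros p" i j] by (simp add: zeros_def)

text \<open>The phase bounds, taken to the limit at a real point x that is no zero, say that f has
  as many zeros beyond x as g, or one more. A violated inequality between zeros leaves room for an x
  where these counts disagree.\<close>

lemma Im_quotient_pos_imp_interlaces:
  assumes f: "real_rooted f" and g: "real_rooted g" and deg: "degree f = degree g + 1"
    and lc: "lead_coeff f / lead_coeff g > 0"
    and pos: "\<And>z. Im z > 0 \<Longrightarrow> Im (poly (cpoly f) z / poly (cpoly g) z) > 0"
  shows "interlaces g f"
proof -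
  define n where "n = degree g"
  define N where "N p x = card {i. i < degree p \<and> x < zeros p ! i}" for p and x :: real
  have bounds: "0 < phase f z - phase g z \<and> phase f z - phase g z < pi" if "Im z > 0" for z
    using phase_difference_bounds[of f g z] pos that Im_quotient_pos_iff[OF f g lc] by blast
  have count: "N g x \<le> N f x \<and> N f x \<le> N g x + 1" if "x \<notin> set (zeros f) \<union> set (zeros g)" for x
  proof -
    have "((\<lambda>y. phase f (Complex x y) - phase g (Complex x y)) \<longlongrightarrow> pi * N f x - pi * N g x) (at_right 0)"
      unfolding N_def using that length_zeros[OF f] length_zeros[OF g]
      by (intro tendsto_diff tendsto_phase_boundary) (auto dest: nth_mem)
    note lim = this
    have ev: "\<forall>\<^sub>F y in at_right 0. 0 < phase f (Complex x y) - phase g (Complex x y) \<and>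
        phase f (Complex x y) - phase g (Complex x y) < pi"
      unfolding eventually_at_right_field using bounds by (intro exI[of _ 1]) auto
    have "0 \<le> pi * N f x - pi * N g x"
      by (rule tendsto_lowerbound[OF lim]) (use ev in \<open>auto elim!: eventually_mono\<close>)
    moreover have "pi * N f x - pi * N g x \<le> pi"
      by (rule tendsto_upperbound[OF lim]) (use ev in \<open>auto elim!: eventually_mono\<close>)
    ultimately have "pi * 0 \<le> pi * (real (N f x) - real (N g x))" "pi * (real (N f x) - real (N g x)) \<le> pi * 1"
      by (simp_all add: algebra_simps)
    then have "0 \<le> real (N f x) - real (N g x)" "real (N f x) - real (N g x) \<le> 1"
      using mult_le_cancel_left_pos[OF pi_gt_zero] by blast+
    then show ?thesis by linarith
  qed
  have between: "\<exists>x. a < x \<and> x < b \<and> x \<notin> set (zeros f) \<union> set (zeros g)" if "a < b" for a b :: real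
  proof -
    have "infinite ({a<..<b} - (set (zeros f) \<union> set (zeros g)))"
      using that by (intro Diff_infinite_finite) auto
    then obtain x where "x \<in> {a<..<b} - (set (zeros f) \<union> set (zeros g))"
      by (metis ex_in_conv finite.emptyI)
    then show ?thesis by auto
  qed
  have lower: "degree p - i \<le> N p x" if "real_rooted p" "i < degree p" "x < zeros p ! i" for p i x
  proof -
    have "card {i..<degree p} \<le> N p x"
      unfolding N_def
    proof (intro card_mono subsetI)
      fix j assume "j \<in> {i..<degree p}"
      then show "j \<in> {j. j < degree p \<and> x < zeros p ! j}"
        using that sorted_zeros[of i j p] by auto
    qed simp
    then show ?thesis by simp
  qed
  have upper: "N p x \<le> degree p - Suc i" if "real_rooted p" "i < degree p" "zeros p ! i < x" for p i x
  proof -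
    have "N p x \<le> card {Suc i..<degree p}"
      unfolding N_def
    proof (intro card_mono subsetI)
      fix j assume "j \<in> {j. j < degree p \<and> x < zeros p ! j}"
      then show "j \<in> {Suc i..<degree p}"
        using that sorted_zeros[of j i p] by (cases "j \<le> i") auto
    qed simp
    then show ?thesis by simp
  qed
  have "zeros f ! i \<le> zeros g ! i \<and> zeros g ! i \<le> zeros f ! (i + 1)" if i: "i < degree g" for i
  proof (intro conjI leI notI)
    assume "zeros g ! i < zeros f ! i"
    then obtain x where x: "zeros g ! i < x" "x < zeros f ! i" "x \<notin> set (zeros f) \<union> set (zeros g)"
      using between by blast
    \<comment> \<open>With n the degree of g, f has at least n + 1 - i zeros beyond x and g at most
      n - i - 1, a difference of at least 2.\<close>
    show False
      using count[OF x(3)] lower[OF f _ x(2)] upper[OF g i x(1)] i deg by linarith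
  next
    assume "zeros f ! (i + 1) < zeros g ! i"
    then obtain x where x: "zeros f ! (i + 1) < x" "x < zeros g ! i" "x \<notin> set (zeros f) \<union> set (zeros g)"
      using between by blast
    \<comment> \<open>Here g has at least n - i zeros beyond x, but f at most n - i - 1.\<close>
    show False
      using count[OF x(3)] lower[OF g i x(2)] upper[OF f _ x(1)] i deg by linarith
  qed
  then show ?thesis using f g deg by (simp add: interlaces_def)
qed

section \<open>Stability of the diamond product\<close>

lemma lead_coeff_higher_pderiv:
  fixes p :: "real poly"
  shows "lead_coeff ((pderiv ^^ n) p) = pochhammer (real (Suc (degree p - n))) n * coeff p (degree p - n + n)"
  by (simp only: degree_higher_pderiv coeff_higher_pderiv)

text \<open>Differentiation removes n degrees from each factor and x^n (x + 1)^n restores 2 n; the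
  leading coefficients only pick up positive factors.\<close>

lemma diamond_summand_leading:
  fixes f h :: "real poly"
  assumes "f \<noteq> 0" "h \<noteq> 0" "n \<le> degree f" "n \<le> degree h"
  defines "T \<equiv> smult (1 / fact n) ((pderiv ^^ n) f) * smult (1 / fact n) ((pderiv ^^ n) h)
       * [:0, 1:] ^ n * [:1, 1:] ^ n"
  shows "degree T = degree f + degree h" "lead_coeff T / (lead_coeff f * lead_coeff h) > 0"
proof -
  define P where "P p = pochhammer (real (Suc (degree p - n))) n" for p :: "real poly"
  have P: "P p > 0" for p unfolding P_def by (rule pochhammer_pos) simp
  have lc: "lead_coeff ((pderiv ^^ n) p) = P p * lead_coeff p" if "n \<le> degree p" for p :: "real poly"
    using that by (simp only: lead_coeff_higher_pderiv P_def le_add_diff_inverse2)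
  have nz: "(pderiv ^^ n) p \<noteq> 0" if "n \<le> degree p" "p \<noteq> 0" for p :: "real poly"
    using lc[OF that(1)] P[of p] that by force
  show "degree T = degree f + degree h"
    unfolding T_def using nz[OF assms(3,1)] nz[OF assms(4,2)] assms(3,4)
    by (simp add: degree_mult_eq degree_power_eq degree_higher_pderiv)
  have "lead_coeff T = 1 / fact n * (P f * lead_coeff f) * (1 / fact n * (P h * lead_coeff h))"
    unfolding T_def lead_coeff_mult lead_coeff_smult lead_coeff_power lc[OF assms(3)] lc[OF assms(4)]
    by simp
  then have "lead_coeff T / (lead_coeff f * lead_coeff h) = P f * P h / (fact n * fact n)"
    using assms by (simp add: field_simps)
  then show "lead_coeff T / (lead_coeff f * lead_coeff h) > 0" using P by simp
qed

text \<open>The summands up to the degree of h share degree and leading sign, so nothing cancels;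
  later ones vanish, and the one for n = 0 is always present.\<close>

lemma diamond_leading:
  fixes f h :: "real poly"
  assumes "f \<noteq> 0" "h \<noteq> 0"
  shows "degree (f \<Diamond> h) = degree f + degree h"
    and "lead_coeff (f \<Diamond> h) / (lead_coeff f * lead_coeff h) > 0"
proof -
  define T where "T n = smult (1 / fact n) ((pderiv ^^ n) f) * smult (1 / fact n) ((pderiv ^^ n) h)
       * [:0, 1:] ^ n * [:1, 1:] ^ n" for n
  define N where "N = degree f + degree h"
  let ?c = "lead_coeff f * lead_coeff h"
  have D: "f \<Diamond> h = (\<Sum>n\<le>degree f. T n)" by (simp add: diamond_def T_def)
  have small: "degree (T n) = N" "coeff (T n) N / ?c > 0" if "n \<le> degree f" "n \<le> degree h" for n
    using diamond_summand_leading[OF assms that] by (auto simp: T_def N_def)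
  have large: "T n = 0" if "n > degree h" for n
  proof -
    have "degree ((pderiv ^^ n) h) = 0" "coeff ((pderiv ^^ n) h) 0 = 0"
      using that by (simp_all add: degree_higher_pderiv coeff_higher_pderiv coeff_eq_0)
    then have "(pderiv ^^ n) h = 0" using leading_coeff_0_iff by metis
    then show ?thesis by (simp add: T_def)
  qed
  have "degree (T n) \<le> N" if "n \<le> degree f" for n
    using small[OF that] large[of n] by (cases "n \<le> degree h") auto
  then have "degree (f \<Diamond> h) \<le> N"
    unfolding D by (intro degree_sum_le) auto
  have "coeff (T n) N / ?c \<ge> 0" if "n \<le> degree f" for n
    using small(2)[OF that] large[of n] by (cases "n \<le> degree h") auto
  then have "(\<Sum>n\<le>degree f. coeff (T n) N / ?c) > 0"
    using small(2)[of 0] by (intro sum_pos2[of _ 0]) auto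
  then have pos: "coeff (f \<Diamond> h) N / ?c > 0"
    by (simp add: D coeff_sum sum_divide_distrib)
  then have "N \<le> degree (f \<Diamond> h)" by (intro le_degree) auto
  with \<open>degree (f \<Diamond> h) \<le> N\<close> show "degree (f \<Diamond> h) = degree f + degree h" by (simp add: N_def)
  with pos show "lead_coeff (f \<Diamond> h) / ?c > 0" by (simp add: N_def)
qed

lemma diamond_smult_left:
  assumes "c \<noteq> 0"
  shows "smult c g \<Diamond> h = smult c (g \<Diamond> h)"
  using assms by (intro poly_eqI)
    (simp add: diamond_def higher_pderiv_smult coeff_sum sum_distrib_left mult_ac)

section \<open>Absence of zeros in the upper half-plane\<close>

lemma poly_cpoly_cnj: "poly (cpoly p) (cnj z) = cnj (poly (cpoly p) z)"
  by (induction p) (simp_all add: map_poly_pCons)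

text \<open>Non-real zeros of a real polynomial come in conjugate pairs, so the upper half-plane
  suffices.\<close>

lemma real_rootedI:
  assumes "p \<noteq> 0" "\<And>z. Im z > 0 \<Longrightarrow> poly (cpoly p) z \<noteq> 0"
  shows "real_rooted p"
  unfolding real_rooted_def
proof (intro conjI allI impI)
  fix z assume z: "poly (cpoly p) z = 0"
  then have "poly (cpoly p) (cnj z) = 0" by (simp add: poly_cpoly_cnj)
  with z have "\<not> Im z > 0" "\<not> Im (cnj z) > 0" using assms(2) by blast+
  then show "z \<in> \<real>" by (simp add: complex_is_Real_iff)
qed fact

lemma real_rooted_nonzero: "real_rooted p \<Longrightarrow> Im z > 0 \<Longrightarrow> poly (cpoly p) z \<noteq> 0"
  by (auto simp: real_rooted_def complex_is_Real_iff)

text \<open>All zeros of h are real, so z is not among them and the exceptional case of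
  \<open>diamond_at_nonzero\<close> is void.\<close>

lemma diamond_at_stable:
  assumes "rooted_in {-1..0} h" "p \<noteq> 0" "\<And>w. Im w > 0 \<Longrightarrow> poly p w \<noteq> 0" "Im z > 0"
  shows "diamond_at p (cpoly h) z \<noteq> 0"
proof (rule diamond_at_nonzero)
  have root: "\<exists>t\<in>{-1..0}. x = of_real t" if "poly (cpoly h) x = 0" for x
    using assms(1) that unfolding rooted_in_def by blast
  show "cpoly h \<noteq> 0" using assms by (simp add: rooted_in_def)
  show "Im x < Im z" if "poly p x = 0" for x using assms(3)[of x] assms(4) that by force
  show "Im (z * (z + 1) / (z - x)) \<ge> 0" if "poly (cpoly h) x = 0" "x \<noteq> z" for x
    using root[OF that(1)] that(2) assms(4) Im_diamond_weight_nonneg[of z] by auto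
  show "degree p > 0 \<and> order z (cpoly h) = 1 \<and> z * (z + 1) \<noteq> 0" if "poly (cpoly h) z = 0"
    using root[OF that] assms(4) by auto
qed fact

lemma real_rooted_diamond:
  assumes "rooted_in {-1..0} h" "real_rooted f"
  shows "real_rooted (f \<Diamond> h)"
proof (rule real_rootedI)
  have "f \<noteq> 0" "h \<noteq> 0" using assms by (auto simp: real_rooted_def rooted_in_def)
  then show "f \<Diamond> h \<noteq> 0" using diamond_leading(2)[of f h] by auto
  show "poly (cpoly (f \<Diamond> h)) z \<noteq> 0" if "Im z > 0" for z
    unfolding poly_cpoly_diamond using assms that \<open>f \<noteq> 0\<close>
    by (intro diamond_at_stable) (auto dest: real_rooted_nonzero)
qed

text \<open>A zero would force f/g = - \<zeta>, whose imaginary part is not positive.\<close>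

lemma stable_combination:
  assumes "\<And>z. Im z > 0 \<Longrightarrow> Im (poly (cpoly f) z / poly (cpoly g) z) > 0" "Im \<zeta> \<ge> 0" "Im z > 0"
  shows "poly (cpoly f + smult \<zeta> (cpoly g)) z \<noteq> 0"
proof
  assume "poly (cpoly f + smult \<zeta> (cpoly g)) z = 0"
  then have eq: "poly (cpoly f) z = - \<zeta> * poly (cpoly g) z" by (simp add: add_eq_0_iff)
  have "poly (cpoly g) z \<noteq> 0" using assms(1)[OF assms(3)] by force
  then have "poly (cpoly f) z / poly (cpoly g) z = - \<zeta>" by (simp add: eq)
  with assms(1)[OF assms(3)] assms(2) show False by simp
qed

lemma Im_quotient_diamond_pos:
  assumes h: "rooted_in {-1..0} h" and g: "real_rooted g"
    and pos: "\<And>z. Im z > 0 \<Longrightarrow> Im (poly (cpoly f) z / poly (cpoly g) z) > 0" and z: "Im z > 0"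
  shows "Im (poly (cpoly (f \<Diamond> h)) z / poly (cpoly (g \<Diamond> h)) z) > 0"
proof (rule ccontr)
  \<comment> \<open>Chosen so that, by linearity, the diamond product of f + \<zeta> g with h
    vanishes at z. If the claim failed, f + \<zeta> g would be stable and this could not
    happen.\<close>
  define \<zeta> where "\<zeta> = - (poly (cpoly (f \<Diamond> h)) z / poly (cpoly (g \<Diamond> h)) z)"
  define p where "p = cpoly f + smult \<zeta> (cpoly g)"
  assume "\<not> ?thesis"
  then have "Im \<zeta> \<ge> 0" by (simp add: \<zeta>_def)
  then have stable: "poly p w \<noteq> 0" if "Im w > 0" for w
    unfolding p_def using pos that by (intro stable_combination)
  then have "p \<noteq> 0" using z by force
  then have "diamond_at p (cpoly h) z \<noteq> 0"
    using h stable z by (intro diamond_at_stable)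
  moreover have "poly (cpoly (g \<Diamond> h)) z \<noteq> 0"
    using real_rooted_diamond[OF h g] z by (rule real_rooted_nonzero)
  moreover have "diamond_at p (cpoly h) z = poly (cpoly (f \<Diamond> h)) z + \<zeta> * poly (cpoly (g \<Diamond> h)) z"
    by (simp only: p_def diamond_at_add_smult poly_cpoly_diamond)
  ultimately show False by (simp add: \<zeta>_def)
qed

text \<open>A common zero t would be a zero of the diamond product of f + i g with h. But f + i g
  has no zero in the closed upper half-plane: a real one would be common to f and g. So
  \<open>diamond_at_nonzero\<close> applies at the real point t, even if h vanishes there.\<close>

lemma diamond_no_common_root:
  assumes h: "rooted_in {-1<..<0} h" "simple_rooted h"
    and pos: "\<And>z. Im z > 0 \<Longrightarrow> Im (poly (cpoly f) z / poly (cpoly g) z) > 0"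
    and deg: "degree g < degree f"
    and common: "\<And>x. \<not> (poly f x = 0 \<and> poly g x = 0)"
  shows "\<not> (poly (f \<Diamond> h) t = 0 \<and> poly (g \<Diamond> h) t = 0)"
proof
  assume t: "poly (f \<Diamond> h) t = 0 \<and> poly (g \<Diamond> h) t = 0"
  define p where "p = cpoly f + smult \<i> (cpoly g)"
  have degp: "degree p = degree f"
    unfolding p_def using deg by (subst degree_add_eq_left) auto
  have "diamond_at p (cpoly h) (of_real t) \<noteq> 0"
  proof (rule diamond_at_nonzero)
    have root: "\<exists>s\<in>{-1<..<0}. x = of_real s" if "poly (cpoly h) x = 0" for x
      using h(1) that unfolding rooted_in_def by blast
    show "p \<noteq> 0" using degp deg by auto
    show "cpoly h \<noteq> 0" using h by (simp add: rooted_in_def)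
    show "Im x < Im (of_real t)" if x: "poly p x = 0" for x
    proof (rule ccontr)
      assume "\<not> ?thesis"
      moreover have "\<not> Im x > 0"
        using x stable_combination[OF pos, of \<i> x] by (auto simp: p_def)
      ultimately have "x = of_real (Re x)" by (simp add: complex_eq_iff)
      then have "complex_of_real (poly f (Re x)) + \<i> * complex_of_real (poly g (Re x)) = 0"
        using x poly_map_poly_complex_of_real[of f "Re x"] poly_map_poly_complex_of_real[of g "Re x"]
        by (simp add: p_def)
      then show False using common[of "Re x"] by (simp add: complex_eq_iff)
    qed
    show "Im (of_real t * (of_real t + 1) / (of_real t - x)) \<ge> 0"
      if "poly (cpoly h) x = 0" "x \<noteq> of_real t" for x
      using root[OF that(1)] that(2) Im_diamond_weight_nonneg[of "of_real t"] by force
    show "degree p > 0 \<and> order (of_real t) (cpoly h) = 1 \<and> complex_of_real t * (of_real t + 1) \<noteq> 0"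
      if "poly (cpoly h) (of_real t) = 0"
    proof (intro conjI)
      show "degree p > 0" using degp deg by simp
      show "order (of_real t) (cpoly h) = 1"
        using h that by (metis order_root rsquarefree_def simple_rooted_def)
      have "-1 < t" "t < 0" using root[OF that] by auto
      then have "t * (t + 1) \<noteq> 0" by simp
      then show "complex_of_real t * (of_real t + 1) \<noteq> 0"
        by (metis of_real_1 of_real_add of_real_eq_0_iff of_real_mult)
    qed
  qed
  then show False
    using t by (simp add: p_def diamond_at_add_smult poly_map_poly_complex_of_real flip: poly_cpoly_diamond)
qed

section \<open>Interlacing of diamond products\<close>

lemma zeros_smult: "c \<noteq> 0 \<Longrightarrow> zeros (smult c p) = zeros p"
  by (simp add: zeros_def)

lemma real_rooted_smult: "c \<noteq> 0 \<Longrightarrow> real_rooted (smult c p) \<longleftrightarrow> real_rooted p"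
  by (simp add: real_rooted_def cpoly_smult)

lemma interlaces_smult: "c \<noteq> 0 \<Longrightarrow> interlaces (smult c g) f \<longleftrightarrow> interlaces g f"
  by (simp add: interlaces_def zeros_smult real_rooted_smult)

text \<open>Interlacing ignores scalar factors, whereas the half-plane criterion needs leading
  coefficients of equal sign.\<close>

lemma interlaces_normalize:
  assumes "interlaces g f"
  obtains c where "c \<noteq> 0" "interlaces (smult c g) f" "lead_coeff (smult c g) = lead_coeff f"
proof
  have "f \<noteq> 0" "g \<noteq> 0" using assms by (auto simp: interlaces_def real_rooted_def)
  then have nz: "lead_coeff f \<noteq> 0" "lead_coeff g \<noteq> 0" by simp_all
  then show "lead_coeff f / lead_coeff g \<noteq> 0" by simp
  then show "interlaces (smult (lead_coeff f / lead_coeff g) g) f"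
    using assms interlaces_smult by blast
  show "lead_coeff (smult (lead_coeff f / lead_coeff g) g) = lead_coeff f"
    using nz by simp
qed

lemma interlaces_diamond:
  assumes h: "rooted_in {-1..0} h" and "interlaces g f"
  shows "interlaces (g \<Diamond> h) (f \<Diamond> h)"
proof -
  obtain c where c: "c \<noteq> 0" "interlaces (smult c g) f" "lead_coeff (smult c g) = lead_coeff f"
    using interlaces_normalize assms(2) by blast
  define g' where "g' = smult c g"
  have g': "real_rooted g'" "real_rooted f" "degree f = degree g' + 1"
    using c(2) by (auto simp: g'_def interlaces_def)
  have nz: "f \<noteq> 0" "g' \<noteq> 0" "h \<noteq> 0"
    using g' h by (auto simp: real_rooted_def rooted_in_def)
  have lc: "lead_coeff f = lead_coeff g'" using c(3) by (simp add: g'_def)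
  have "lead_coeff f / lead_coeff g' > 0" using lc nz by simp
  then have pos: "Im (poly (cpoly f) z / poly (cpoly g') z) > 0" if "Im z > 0" for z
    using interlaces_imp_Im_quotient_pos c(2) that by (simp add: g'_def)
  have "interlaces (g' \<Diamond> h) (f \<Diamond> h)"
  proof (rule Im_quotient_pos_imp_interlaces)
    show "real_rooted (f \<Diamond> h)" "real_rooted (g' \<Diamond> h)"
      using h g' by (auto intro: real_rooted_diamond)
    show "degree (f \<Diamond> h) = degree (g' \<Diamond> h) + 1"
      using nz g'(3) by (simp add: diamond_leading)
    \<comment> \<open>The leading coefficients of f and g' agree, so the normalizing denominators
      cancel and both remaining quotients are positive.\<close>
    have "lead_coeff (f \<Diamond> h) / lead_coeff (g' \<Diamond> h) =
        (lead_coeff (f \<Diamond> h) / (lead_coeff f * lead_coeff h)) /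
        (lead_coeff (g' \<Diamond> h) / (lead_coeff g' * lead_coeff h))"
      using lc nz by simp
    also have "\<dots> > 0" using diamond_leading(2)[OF nz(1,3)] diamond_leading(2)[OF nz(2,3)] by (rule divide_pos_pos)
    finally show "lead_coeff (f \<Diamond> h) / lead_coeff (g' \<Diamond> h) > 0" .
    show "Im (poly (cpoly (f \<Diamond> h)) z / poly (cpoly (g' \<Diamond> h)) z) > 0" if "Im z > 0" for z
      using h g'(1) pos that by (rule Im_quotient_diamond_pos)
  qed
  then show ?thesis using c(1) by (simp add: g'_def diamond_smult_left interlaces_smult)
qed

section \<open>Strict interlacing and simple zeros\<close>

lemma set_zeros: "p \<noteq> 0 \<Longrightarrow> set (zeros p) = {x. poly p x = 0}"
  by (simp add: zeros_def)

text \<open>Reduces strictness to the absence of common zeros. If the i-th zero of f equals the j-th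
  zero of g, then for i \<le> j sortedness puts it below the j-th zero of g, and for i > j above
  it.\<close>

lemma strictly_interlaces_iff:
  "strictly_interlaces g f \<longleftrightarrow> interlaces g f \<and> (\<forall>x. \<not> (poly f x = 0 \<and> poly g x = 0))"
proof (intro iffI conjI allI notI; (elim conjE)?)
  assume "strictly_interlaces g f"
  then show "interlaces g f"
    by (force simp: strictly_interlaces_def interlaces_def less_imp_le)
next
  fix x assume si: "strictly_interlaces g f" and x: "poly f x = 0" "poly g x = 0"
  then have rr: "real_rooted f" "real_rooted g" and deg: "degree f = degree g + 1"
    and less: "\<And>i. i < degree g \<Longrightarrow> zeros f ! i < zeros g ! i" "\<And>i. i < degree g \<Longrightarrow> zeros g ! i < zeros f ! (i + 1)"
    by (auto simp: strictly_interlaces_def)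
  have "f \<noteq> 0" "g \<noteq> 0" using rr by (auto simp: real_rooted_def)
  then have "x \<in> set (zeros f)" "x \<in> set (zeros g)" using x by (simp_all add: set_zeros)
  then obtain i j where i: "i < degree f" "zeros f ! i = x" and j: "j < degree g" "zeros g ! j = x"
    using length_zeros rr by (metis in_set_conv_nth)
  show False
  proof (cases "i \<le> j")
    case True
    then show False using sorted_zeros[of i j f] less(1)[of j] rr deg i j by auto
  next
    case False
    then show False using sorted_zeros[of "j + 1" i f] less(2)[of j] rr deg i j by auto
  qed
next
  assume il: "interlaces g f" and common: "\<forall>x. \<not> (poly f x = 0 \<and> poly g x = 0)"
  then have rr: "real_rooted f" "real_rooted g" and deg: "degree f = degree g + 1"
    and le: "\<And>i. i < degree g \<Longrightarrow> zeros f ! i \<le> zeros g ! i \<and> zeros g ! i \<le> zeros f ! (i + 1)"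
    by (auto simp: interlaces_def)
  have root: "poly p (zeros p ! i) = 0" if "real_rooted p" "i < degree p" for p i
    using nth_mem[of i "zeros p"] length_zeros[OF that(1)] that set_zeros[of p]
    by (auto simp: real_rooted_def)
  have "zeros f ! i \<noteq> zeros g ! i \<and> zeros g ! i \<noteq> zeros f ! (i + 1)" if "i < degree g" for i
    using root[OF rr(1), of i] root[OF rr(2), of i] root[OF rr(1), of "i + 1"] common that deg
    by (metis add_less_cancel_right trans_less_add1)
  then show "strictly_interlaces g f"
    using le rr deg by (simp add: strictly_interlaces_def order_less_le)
qed

lemma simple_rooted_iff:
  assumes "real_rooted p"
  shows "simple_rooted p \<longleftrightarrow> rsquarefree p"
proof -
  have "poly (cpoly p) (of_real x) = 0 \<and> poly (pderiv (cpoly p)) (of_real x) = 0 \<longleftrightarrow>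
      poly p x = 0 \<and> poly (pderiv p) x = 0" for x
    by (simp add: poly_map_poly_complex_of_real flip: cpoly_pderiv)
  moreover have "z \<in> \<real>" if "poly (cpoly p) z = 0" for z
    using assms that by (simp add: real_rooted_def)
  ultimately show ?thesis
    unfolding simple_rooted_def rsquarefree_roots by (metis Reals_cases)
qed

text \<open>A zero of g separates consecutive zeros of f strictly, so \<open>zeros f\<close> has no
  repetitions.\<close>

lemma strictly_interlaces_imp_simple_rooted:
  assumes "strictly_interlaces g f"
  shows "simple_rooted f"
proof -
  have rr: "real_rooted f" "real_rooted g" and deg: "degree f = degree g + 1"
    and less: "\<And>i. i < degree g \<Longrightarrow> zeros f ! i < zeros g ! i \<and> zeros g ! i < zeros f ! (i + 1)"
    using assms by (auto simp: strictly_interlaces_def)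
  have "zeros f ! i < zeros f ! j" if "i < j" "j < degree f" for i j
    using less[of i] sorted_zeros[of "i + 1" j f] that deg rr by force
  then have "distinct (zeros f)"
    unfolding distinct_conv_nth length_zeros[OF rr(1)] by (metis less_irrefl linorder_neqE_nat)
  then have "count (proots f) x \<le> 1" for x
    unfolding zeros_def by (metis distinct_count_atmost_1 mset_sorted_list_of_multiset zero_le order_refl)
  moreover have "f \<noteq> 0" using rr by (simp add: real_rooted_def)
  ultimately have "rsquarefree f"
    by (auto simp: rsquarefree_def le_Suc_eq)
  with rr show ?thesis by (simp add: simple_rooted_iff)
qed

text \<open>The logarithmic derivative f'/f is the sum of 1 / (z - a_i), all in the lower
  half-plane; its reciprocal lies in the upper one. Positive degree keeps the sum nonempty.\<close>

lemma Im_quotient_pderiv_pos: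
  assumes "real_rooted f" "degree f > 0" "Im z > 0"
  shows "Im (poly (cpoly f) z / poly (cpoly (pderiv f)) z) > 0"
proof -
  define a where "a i = complex_of_real (zeros f ! i)" for i
  define F where "F = (\<Prod>i<degree f. z - a i)"
  define S where "S = (\<Sum>i<degree f. 1 / (z - a i))"
  have Im: "Im (z - a i) > 0" for i using assms by (simp add: a_def)
  then have nz: "z - a i \<noteq> 0" for i by (metis less_irrefl zero_complex.sel(2))
  have "cpoly f = smult (of_real (lead_coeff f)) (\<Prod>i<degree f. [:- a i, 1:])"
    by (subst (1) real_rooted_factorization[OF assms(1)])
      (simp add: cpoly_smult cpoly_prod map_poly_pCons a_def)
  then have f: "poly (cpoly f) z = of_real (lead_coeff f) * F"
    and "poly (cpoly (pderiv f)) z =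
      of_real (lead_coeff f) * (\<Sum>i<degree f. \<Prod>j\<in>{..<degree f} - {i}. z - a j)"
    by (simp_all add: F_def poly_prod poly_sum cpoly_pderiv pderiv_smult pderiv_prod pderiv_pCons)
  moreover have "(\<Prod>j\<in>{..<degree f} - {i}. z - a j) = F * (1 / (z - a i))" if "i < degree f" for i
    using that nz[of i] by (simp add: F_def prod.remove[of "{..<degree f}" i])
  ultimately have "poly (cpoly (pderiv f)) z = of_real (lead_coeff f) * F * S"
    by (simp add: S_def sum_distrib_left mult.assoc)
  moreover have "of_real (lead_coeff f) * F \<noteq> 0"
    using real_rooted_nonzero[OF assms(1,3)] f by simp
  ultimately have "poly (cpoly f) z / poly (cpoly (pderiv f)) z = 1 / S"
    using f by simp
  moreover have "Im (1 / (z - a i)) < 0" for i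
    using assms(3) by (auto simp: a_def Im_divide intro!: divide_pos_pos add_nonneg_pos)
  then have "Im S < 0"
    unfolding S_def Im_sum using assms(2) sum_strict_mono[of "{..<degree f}" "\<lambda>i. Im (1 / (z - a i))" "\<lambda>_. 0"]
    by fastforce
  then have "Im (1 / S) > 0"
    by (auto simp: Im_divide intro!: divide_neg_pos add_nonneg_pos)
  ultimately show ?thesis by simp
qed

lemma pderiv_interlaces:
  assumes "real_rooted f" "degree f > 0"
  shows "interlaces (pderiv f) f"
proof (rule Im_quotient_pos_imp_interlaces)
  have pos: "Im (poly (cpoly f) z / poly (cpoly (pderiv f)) z) > 0" if "Im z > 0" for z
    using Im_quotient_pderiv_pos assms that by blast
  then show "Im z > 0 \<Longrightarrow> Im (poly (cpoly f) z / poly (cpoly (pderiv f)) z) > 0" for z .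
  have nz: "pderiv f \<noteq> 0" using assms by (simp add: pderiv_eq_0_iff)
  show "real_rooted (pderiv f)"
  proof (rule real_rootedI[OF nz])
    \<comment> \<open>At a zero of f' the quotient would be 0 by the convention for division, hence
      not in the upper half-plane.\<close>
    show "poly (cpoly (pderiv f)) z \<noteq> 0" if "Im z > 0" for z
      using pos[OF that] by force
  qed
  show "degree f = degree (pderiv f) + 1" using assms by (simp add: degree_pderiv)
  have "lead_coeff (pderiv f) = real (degree f) * lead_coeff f"
    using assms(2) by (simp add: degree_pderiv coeff_pderiv)
  then show "lead_coeff f / lead_coeff (pderiv f) > 0" using assms nz by auto
qed fact

lemma strictly_interlaces_diamond:
  assumes h: "rooted_in {-1<..<0} h" "simple_rooted h" and si: "strictly_interlaces g f"
  shows "strictly_interlaces (g \<Diamond> h) (f \<Diamond> h)"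
proof -
  have h': "rooted_in {-1..0} h"
    using h(1) unfolding rooted_in_def by (meson greaterThanLessThan_subseteq_atLeastAtMost_iff image_mono order_refl subsetD)
  have il: "interlaces g f" and common: "\<And>x. \<not> (poly f x = 0 \<and> poly g x = 0)"
    using si by (auto simp: strictly_interlaces_iff)
  obtain c where c: "c \<noteq> 0" "interlaces (smult c g) f" "lead_coeff (smult c g) = lead_coeff f"
    using interlaces_normalize il by blast
  have "lead_coeff f / lead_coeff (smult c g) > 0"
    using c il by (auto simp: interlaces_def real_rooted_def)
  then have pos: "Im (poly (cpoly f) z / poly (cpoly (smult c g)) z) > 0" if "Im z > 0" for z
    using interlaces_imp_Im_quotient_pos c(2) that by blast
  have "\<not> (poly (f \<Diamond> h) t = 0 \<and> poly (smult c g \<Diamond> h) t = 0)" for t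
  proof (rule diamond_no_common_root[OF h pos])
    show "degree (smult c g) < degree f" using c(2) by (simp add: interlaces_def)
    show "\<not> (poly f x = 0 \<and> poly (smult c g) x = 0)" for x using common c(1) by simp
  qed
  then show ?thesis
    using interlaces_diamond[OF h' il] c(1) by (simp add: strictly_interlaces_iff diamond_smult_left)
qed

text \<open>Simple zeros mean that f and f' have no common zero, so f' interlaces f strictly and the
  strict result applies. Constants are separate, since their derivative vanishes.\<close>

lemma simple_rooted_diamond:
  assumes h: "rooted_in {-1<..<0} h" "simple_rooted h" and f: "real_rooted f" "simple_rooted f"
  shows "simple_rooted (f \<Diamond> h)"
proof (cases "degree f = 0")
  case True
  then obtain c where c: "f = [:c:]" by (rule degree_eq_zeroE)
  with f have "c \<noteq> 0" by (auto simp: real_rooted_def)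
  have "f \<Diamond> h = smult c h" by (simp add: c diamond_def)
  then show ?thesis
    using h(2) \<open>c \<noteq> 0\<close> by (simp add: simple_rooted_def rsquarefree_roots cpoly_smult pderiv_smult)
next
  case False
  have "strictly_interlaces (pderiv f) f"
    using f False pderiv_interlaces[OF f(1)] simple_rooted_iff[OF f(1)]
    by (auto simp: strictly_interlaces_iff rsquarefree_roots)
  then show ?thesis
    using strictly_interlaces_diamond[OF h] strictly_interlaces_imp_simple_rooted by blast
qed

theorem theorem12:
  fixes f h :: "real poly"
  assumes "rooted_in {-1..0} h" and "real_rooted f"
  shows "(real_rooted (f \<Diamond> h) \<and>
          (\<forall>g :: real poly. interlaces g f \<longrightarrow> interlaces (g \<Diamond> h) (f \<Diamond> h))) \<and>
         (rooted_in {-1<..<0} h \<and> simple_rooted h \<and> simple_rooted f \<longrightarrow>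
          simple_rooted (f \<Diamond> h) \<and>
          (\<forall>g :: real poly. strictly_interlaces g f \<longrightarrow>
             strictly_interlaces (g \<Diamond> h) (f \<Diamond> h)))"
  using assms real_rooted_diamond interlaces_diamond simple_rooted_diamond strictly_interlaces_diamond
  by blast

end
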